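(* Consider the system of expressions $\mathcal{I}$ in the variables $y$ and $x_{n,j}$ ($n\in\mathbb{N}$, $1\le j\le n$), consisting of the expressions $x_{n,1}+\dots+x_{n,n}+2^n y$ for each $n\in\mathbb{N}$, together with each single variable $y$ and $x_{n,j}$. Then: (1) $\mathcal{I}$ is image partition regular over $\mathbb{N}$: whenever $\mathbb{N}$ is finitely coloured, there are values of the variables such that all expressions in $\mathcal{I}$ take values in $\mathbb{N}$ and all these values have the same colour; (2) $\mathcal{I}$ is not image partition regular over $\mathbb{R}$ near zero: it is not the case that for every $\delta>0$, whenever $(-\delta,\delta)\setminus\{0\}$ is finitely coloured, there are real values of the variables such that all expressions in $\mathcal{I}$ take values in $(-\delta,\delta)\setminus\{0\}$ and all these values have the same colour.
   Context: $\mathbb{N}=\{1,2,3,\dots\}$. A matrix $A$ (rational entries, finitely many non-zero entries per row) is image partition regular over $\mathbb{N}$ if whenever $\mathbb{N}$ is finitely coloured there is $x$ with $Ax$ monochromatic with entries in $\mathbb{N}$; it is image partition regular over $\mathbb{R}$ near zero if for all $\delta>0$, whenever $(-\delta,\delta)\setminus\{0\}$ is finitely coloured, there is a real vector $x$ with $Ax$ monochromatic and contained in $(-\delta,\delta)\setminus\{0\}$. The system $\mathcal{I}$ corresponds to the matrix whose rows give the listed expressions. *)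

theory Defs
  imports Complex_Main
begin

text \<open>
  A rational matrix with possibly infinite index sets is a function \<open>A\<close> together with the set \<open>R\<close>
  of its row indices and the set \<open>C\<close> of its column indices; entries outside \<open>R \<times> C\<close> are irrelevant.
\<close>

definition row_finite :: "'r set \<Rightarrow> 'c set \<Rightarrow> ('r \<Rightarrow> 'c \<Rightarrow> rat) \<Rightarrow> bool" where
  "row_finite R C A \<longleftrightarrow> (\<forall>i\<in>R. finite {j \<in> C. A i j \<noteq> 0})"

text \<open>The sum runs over the support of the row only, as \<^term>\<open>sum\<close> is 0 on infinite sets.\<close>

definition mat_vec :: "'c set \<Rightarrow> ('r \<Rightarrow> 'c \<Rightarrow> rat) \<Rightarrow> ('c \<Rightarrow> real) \<Rightarrow> 'r \<Rightarrow> real" where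
  "mat_vec C A x i = (\<Sum>j\<in>{j \<in> C. A i j \<noteq> 0}. of_rat (A i j) * x j)"

text \<open>
  Whenever \<open>S\<close> is finitely coloured, some vector has all entries of its image in \<open>S\<close> and of the same
  colour. The colours are natural numbers, only finitely many of which are used on \<open>S\<close>; the values of
  the colouring outside \<open>S\<close> play no role.
\<close>

definition image_partition_regular_on ::
  "real set \<Rightarrow> 'r set \<Rightarrow> 'c set \<Rightarrow> ('r \<Rightarrow> 'c \<Rightarrow> rat) \<Rightarrow> bool" where
  "image_partition_regular_on S R C A \<longleftrightarrow>
     (\<forall>c :: real \<Rightarrow> nat. finite (c ` S) \<longrightarrow>
        (\<exists>x k. \<forall>i\<in>R. mat_vec C A x i \<in> S \<and> c (mat_vec C A x i) = k))"

text \<open>The natural numbers start at 1 here, hence the removal of 0 from \<^term>\<open>\<nat> :: real set\<close>.\<close>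

definition image_partition_regular_nat ::
  "'r set \<Rightarrow> 'c set \<Rightarrow> ('r \<Rightarrow> 'c \<Rightarrow> rat) \<Rightarrow> bool" where
  "image_partition_regular_nat R C A \<longleftrightarrow> image_partition_regular_on (\<nat> - {0}) R C A"

definition image_partition_regular_real_near_zero ::
  "'r set \<Rightarrow> 'c set \<Rightarrow> ('r \<Rightarrow> 'c \<Rightarrow> rat) \<Rightarrow> bool" where
  "image_partition_regular_real_near_zero R C A \<longleftrightarrow>
     (\<forall>\<delta>>0. image_partition_regular_on ({-\<delta><..<\<delta>} - {0}) R C A)"

datatype sys_var = Y | X nat nat

datatype sys_expr = SumExpr nat | VarExpr sys_var

definition sys_vars :: "sys_var set" where
  "sys_vars = {Y} \<union> {X n j | n j. 1 \<le> n \<and> 1 \<le> j \<and> j \<le> n}"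

definition sys_exprs :: "sys_expr set" where
  "sys_exprs = {SumExpr n | n. 1 \<le> n} \<union> {VarExpr v | v. v \<in> sys_vars}"

fun sys_matrix :: "sys_expr \<Rightarrow> sys_var \<Rightarrow> rat" where
  "sys_matrix (SumExpr n) Y = 2 ^ n"
| "sys_matrix (SumExpr n) (X m j) = (if m = n then 1 else 0)"
| "sys_matrix (VarExpr v) w = (if w = v then 1 else 0)"

lemma sys_support_SumExpr:
  assumes "1 \<le> n"
  shows "{v \<in> sys_vars. sys_matrix (SumExpr n) v \<noteq> 0} = insert Y (X n ` {1..n})"
proof (rule set_eqI)
  fix v
  show "v \<in> {v \<in> sys_vars. sys_matrix (SumExpr n) v \<noteq> 0} \<longleftrightarrow> v \<in> insert Y (X n ` {1..n})"
    using assms by (cases v) (auto simp: sys_vars_def)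
qed

lemma sys_support_VarExpr:
  assumes "v \<in> sys_vars"
  shows "{w \<in> sys_vars. sys_matrix (VarExpr v) w \<noteq> 0} = {v}"
  using assms by auto

lemma row_finite_sys: "row_finite sys_exprs sys_vars sys_matrix"
  unfolding row_finite_def
proof
  fix i assume "i \<in> sys_exprs"
  then consider n where "i = SumExpr n" "1 \<le> n" | v where "i = VarExpr v" "v \<in> sys_vars"
    by (auto simp: sys_exprs_def)
  then show "finite {j \<in> sys_vars. sys_matrix i j \<noteq> 0}"
    by cases (simp_all only: sys_support_SumExpr sys_support_VarExpr finite_insert finite_imageI
        finite_atLeastAtMost finite.emptyI)
qed

lemma mat_vec_SumExpr:
  assumes "1 \<le> n"
  shows "mat_vec sys_vars sys_matrix x (SumExpr n) = (\<Sum>j=1..n. x (X n j)) + 2 ^ n * x Y"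
proof -
  have "inj_on (X n) {1..n}" by (auto intro: inj_onI)
  then show ?thesis
    unfolding mat_vec_def sys_support_SumExpr[OF assms]
    by (subst sum.insert) (auto simp: sum.reindex of_rat_power)
qed

lemma mat_vec_VarExpr:
  assumes "v \<in> sys_vars"
  shows "mat_vec sys_vars sys_matrix x (VarExpr v) = x v"
  unfolding mat_vec_def sys_support_VarExpr[OF assms] by simp

end

theory Submission
  imports Defs "HOL-Library.FuncSet" "HOL-Real_Asymp.Real_Asymp"
begin

text \<open>
  Near zero all values are bounded, so \<open>2 ^ n * y\<close> grows at most linearly in \<open>n\<close>, which forces
  \<open>y = 0\<close>; a single colour suffices.

  Over the positive integers, for small \<open>n\<close> take one variable \<open>x n j\<close> equal to \<open>a\<close> and the others
  equal to \<open>y\<close>, with \<open>y\<close> and \<open>a + i * y\<close> (\<open>i \<le> L\<close>) monochromatic by Brauer's theorem. For large \<open>n\<close>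
  it is enough that the colour class \<open>A\<close> has positive upper density: then \<open>A - A\<close> is syndetic, and
  boundedly many further summands from \<open>A\<close> fill its gaps. The two choices fit together because the
  classes of density zero miss all of \<open>d, 2 * d, \<dots>, M * d\<close> for some \<open>d\<close>, and Brauer's theorem can be
  applied to these multiples.
\<close>

section \<open>Van der Waerden's and Brauer's theorems\<close>

text \<open>
  The demand that the term after the progression also lies below the bound gives the focus of the
  colour focusing argument.
\<close>

definition vdw_bound :: "nat \<Rightarrow> nat \<Rightarrow> nat \<Rightarrow> bool" where
  "vdw_bound k r W \<longleftrightarrow> (\<forall>c :: nat \<Rightarrow> nat. c ` {..<W} \<subseteq> {..<r} \<longrightarrow>
     (\<exists>a d. 0 < d \<and> a + k * d < W \<and> (\<forall>i<k. c (a + i * d) = c a)))"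

text \<open>An enumeration of \<open>C\<close> transports the bound to colours of any type. This is
  needed for colouring blocks by their patterns, which are functions.\<close>

lemma vdw_boundD:
  fixes c :: "nat \<Rightarrow> 'a"
  assumes "vdw_bound k (card C) W" "finite C" "c ` {..<W} \<subseteq> C"
  obtains a d where "0 < d" "a + k * d < W" "\<And>i. i < k \<Longrightarrow> c (a + i * d) = c a"
proof -
  obtain h where h: "bij_betw h C {0..<card C}"
    using ex_bij_betw_finite_nat[OF assms(2)] by blast
  have inj: "inj_on h C" using h by (rule bij_betw_imp_inj_on)
  have "(h \<circ> c) ` {..<W} \<subseteq> {..<card C}"
    using h assms(3) unfolding bij_betw_def by fastforce
  then obtain a d where ad: "0 < d" "a + k * d < W" "\<forall>i<k. (h \<circ> c) (a + i * d) = (h \<circ> c) a"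
    using assms(1) unfolding vdw_bound_def by blast
  have "c (a + i * d) = c a" if "i < k" for i
  proof -
    have "i * d \<le> k * d" using that by simp
    then have "a + i * d < W" "a < W" using ad(2) by linarith+
    then have "c (a + i * d) \<in> C" "c a \<in> C" using assms(3) by auto
    moreover have "h (c (a + i * d)) = h (c a)" using ad(3) that by simp
    ultimately show ?thesis using inj by (simp add: inj_on_eq_iff)
  qed
  then show ?thesis using that ad by blast
qed

text \<open>The progressions, one for each colour in \<open>Q\<close>, share the next term
  \<open>f\<close>. If \<open>f\<close> has a colour in \<open>Q\<close>, it extends one of them to
  \<open>k + 1\<close> terms.\<close>

definition focused :: "nat \<Rightarrow> (nat \<Rightarrow> nat) \<Rightarrow> nat \<Rightarrow> nat set \<Rightarrow> bool" where
  "focused k c f Q \<longleftrightarrow>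
     (\<forall>q\<in>Q. \<exists>a d. 0 < d \<and> f = a + k * d \<and> (\<forall>i<k. c (a + i * d) = q))"

definition has_ap :: "nat \<Rightarrow> (nat \<Rightarrow> nat) \<Rightarrow> nat \<Rightarrow> bool" where
  "has_ap k c N \<longleftrightarrow> (\<exists>a d. 0 < d \<and> a + k * d < N \<and> (\<forall>i\<le>k. c (a + i * d) = c a))"

lemma focused_has_ap:
  assumes "focused k c f Q" "c f \<in> Q" "f < N"
  shows "has_ap k c N"
proof -
  obtain a d where ad: "0 < d" "f = a + k * d" "\<forall>i<k. c (a + i * d) = c f"
    using assms unfolding focused_def by blast
  then have "\<forall>i\<le>k. c (a + i * d) = c f" using le_neq_implies_less by blast
  moreover from this have "c a = c f" by (metis add.right_neutral le0 mult_0)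
  ultimately show ?thesis using ad assms(3) unfolding has_ap_def by metis
qed

lemma has_ap_shift:
  assumes "has_ap k (\<lambda>i. c (b + i)) N" "b + N \<le> N'"
  shows "has_ap k c N'"
proof -
  obtain a d where "0 < d" "a + k * d < N" "\<forall>i\<le>k. c (b + (a + i * d)) = c (b + a)"
    using assms(1) unfolding has_ap_def by blast
  then have "0 < d \<and> (b + a) + k * d < N' \<and> (\<forall>i\<le>k. c ((b + a) + i * d) = c (b + a))"
    using assms(2) by (simp add: add.assoc)
  then show ?thesis unfolding has_ap_def by blast
qed

text \<open>Induction on the number \<open>s\<close> of focused colours. Split an interval into
  blocks of length \<open>N\<close> and colour each block by its pattern. The assumption on length
  \<open>k\<close> gives \<open>k\<close> blocks in progression with equal patterns. Inside the
  first block there is a progression of length \<open>k + 1\<close>, or \<open>s\<close> colours are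
  focused at \<open>f\<close>. Copies of \<open>f\<close> then form a progression in a new colour,
  and the old progressions, run diagonally through the blocks, end at the same new focus.\<close>

lemma focusing:
  assumes "\<And>r. \<exists>W. vdw_bound k r W" "0 < k"
  shows "\<exists>N>0. \<forall>c :: nat \<Rightarrow> nat. c ` {..<N} \<subseteq> {..<r} \<longrightarrow>
     has_ap k c N \<or> (\<exists>f Q. f < N \<and> finite Q \<and> card Q = s \<and> focused k c f Q)"
proof (induction s)
  case 0
  show ?case by (rule exI[of _ 1]) (auto simp: focused_def intro!: exI[of _ "{}"])
next
  case (Suc s)
  then obtain N where N: "0 < N" and IH: "\<And>c :: nat \<Rightarrow> nat. c ` {..<N} \<subseteq> {..<r} \<Longrightarrow>
     has_ap k c N \<or> (\<exists>f Q. f < N \<and> finite Q \<and> card Q = s \<and> focused k c f Q)" by blast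
  define P where "P = ({..<N} \<rightarrow>\<^sub>E {..<r})"
  have finP: "finite P" unfolding P_def by (intro finite_PiE) auto
  obtain W where W: "vdw_bound k (card P) W" using assms(1) by blast
  have "W \<noteq> 0"
  proof
    assume "W = 0"
    with W have "\<exists>a d. 0 < d \<and> a + k * d < (0::nat)" unfolding vdw_bound_def by auto
    then show False by simp
  qed
  have "has_ap k c (W * N) \<or> (\<exists>f Q. f < W * N \<and> finite Q \<and> card Q = Suc s \<and> focused k c f Q)"
    if c: "c ` {..<W * N} \<subseteq> {..<r}" for c :: "nat \<Rightarrow> nat"
  proof -
    have block: "b * N + i < W * N" if "b < W" "i < N" for b i
    proof -
      have "b * N + i < Suc b * N" using that by simp
      also have "\<dots> \<le> W * N" using that by (intro mult_le_mono1) simp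
      finally show ?thesis .
    qed
    \<comment> \<open>The pattern of block \<open>b\<close>, restricted to \<open>{..<N}\<close> so
      that it lies in the finite set \<open>P\<close>.\<close>
    define B where "B b = (\<lambda>i\<in>{..<N}. c (b * N + i))" for b
    have "B ` {..<W} \<subseteq> P"
      unfolding B_def P_def using block c by (auto simp: image_subset_iff)
    then obtain b D where D: "0 < D" "b + k * D < W" "\<And>i. i < k \<Longrightarrow> B (b + i * D) = B b"
      using vdw_boundD[OF W finP] by metis
    have same: "c ((b + i * D) * N + j) = c (b * N + j)" if "i < k" "j < N" for i j
      using fun_cong[OF D(3)[OF that(1)], of j] that(2) by (simp add: B_def)
    define c' where "c' i = c (b * N + i)" for i
    have "b < W" using D(2) by linarith
    then have "c' ` {..<N} \<subseteq> {..<r}"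
      using c block unfolding c'_def by (auto simp: image_subset_iff)
    from IH[OF this] show ?thesis
    proof
      assume "has_ap k c' N"
      moreover have "b * N + N \<le> W * N"
        using \<open>b < W\<close> mult_le_mono1[of "Suc b" W N] by simp
      ultimately show ?thesis unfolding c'_def using has_ap_shift by blast
    next
      assume "\<exists>f Q. f < N \<and> finite Q \<and> card Q = s \<and> focused k c' f Q"
      then obtain f Q where f: "f < N" "finite Q" "card Q = s" and Q: "focused k c' f Q" by blast
      show ?thesis
      proof (cases "c' f \<in> Q")
        case True
        then have "has_ap k c' N" using focused_has_ap Q f(1) by blast
        moreover have "b * N + N \<le> W * N"
          using \<open>b < W\<close> mult_le_mono1[of "Suc b" W N] by simp
        ultimately show ?thesis unfolding c'_def using has_ap_shift by blast
      next
        case False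
        \<comment> \<open>The new focus is the copy of \<open>f\<close> in the block following the
          progression of blocks; \<open>b + k * D < W\<close> keeps that block in range.\<close>
        define g where "g = (b + k * D) * N + f"
        have "g < W * N" unfolding g_def using block D(2) f(1) by blast
        moreover have "focused k c g (insert (c' f) Q)"
          unfolding focused_def
        proof
          fix q assume "q \<in> insert (c' f) Q"
          then consider "q = c' f" | "q \<in> Q" by blast
          then show "\<exists>a d. 0 < d \<and> g = a + k * d \<and> (\<forall>i<k. c (a + i * d) = q)"
          proof cases
            case 1
            have "c (b * N + f + i * (D * N)) = q" if "i < k" for i
              using same[OF that f(1)] 1 unfolding c'_def by (simp add: algebra_simps)
            moreover have "g = b * N + f + k * (D * N)" unfolding g_def by (simp add: algebra_simps)
            moreover have "0 < D * N" using D(1) N by simp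
            ultimately show ?thesis by blast
          next
            case 2
            then obtain a d where ad: "0 < d" "f = a + k * d" "\<forall>i<k. c' (a + i * d) = q"
              using Q unfolding focused_def by blast
            \<comment> \<open>Diagonal step: the \<open>i\<close>-th term is taken from the
              \<open>i\<close>-th of the equally coloured blocks.\<close>
            have "c (b * N + a + i * (d + D * N)) = q" if "i < k" for i
            proof -
              have "i * d \<le> k * d" using that by simp
              then have "a + i * d < N" using ad(2) f(1) by linarith
              from same[OF that this] have "c ((b + i * D) * N + (a + i * d)) = q"
                using ad(3) that unfolding c'_def by simp
              then show ?thesis by (simp add: algebra_simps)
            qed
            moreover have "g = b * N + a + k * (d + D * N)"
              unfolding g_def ad(2) by (simp add: algebra_simps)
            moreover have "0 < d + D * N" using ad(1) by simp
            ultimately show ?thesis by blast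
          qed
        qed
        moreover have "card (insert (c' f) Q) = Suc s" using False f by simp
        ultimately show ?thesis using f(2) by blast
      qed
    qed
  qed
  moreover have "0 < W * N" using N \<open>W \<noteq> 0\<close> by simp
  ultimately show ?case by blast
qed

text \<open>Induction on the length. Once \<open>r\<close> colours are focused at one point, the
  colour of that point is among them, so it completes a progression of length
  \<open>k + 1\<close>.\<close>

theorem van_der_waerden: "\<exists>W. vdw_bound k r W"
proof (induction k arbitrary: r)
  case 0
  show ?case by (rule exI[of _ 1]) (auto simp: vdw_bound_def)
next
  case (Suc k)
  show ?case
  proof (cases "k = 0")
    case True
    then show ?thesis
      unfolding vdw_bound_def
      by (intro exI[of _ 2] allI impI exI[of _ "0::nat"] exI[of _ "1::nat"]) auto
  next
    case False
    then obtain N where N: "\<And>c :: nat \<Rightarrow> nat. c ` {..<N} \<subseteq> {..<r} \<Longrightarrow>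
       has_ap k c N \<or> (\<exists>f Q. f < N \<and> finite Q \<and> card Q = r \<and> focused k c f Q)"
      using focusing[of k r r] Suc.IH by blast
    have "\<exists>a d. 0 < d \<and> a + Suc k * d < 2 * N \<and> (\<forall>i<Suc k. c (a + i * d) = c a)"
      if c: "c ` {..<2 * N} \<subseteq> {..<r}" for c :: "nat \<Rightarrow> nat"
    proof -
      have c': "c ` {..<N} \<subseteq> {..<r}" using c by (auto simp: image_subset_iff)
      have "has_ap k c N"
      proof (rule ccontr)
        assume no: "\<not> has_ap k c N"
        then obtain f Q where f: "f < N" "finite Q" "card Q = r" and Q: "focused k c f Q"
          using N[OF c'] by blast
        have "Q \<subseteq> {..<r}"
        proof
          fix q assume "q \<in> Q"
          then obtain a d where "f = a + k * d" "\<forall>i<k. c (a + i * d) = q"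
            using Q unfolding focused_def by blast
          then have "c a = q" "a < N" using False f(1) by (auto dest: spec[of _ 0])
          then show "q \<in> {..<r}" using c' by auto
        qed
        then have "Q = {..<r}" using f by (simp add: card_subset_eq)
        then have "c f \<in> Q" using c' f(1) by auto
        then show False using focused_has_ap Q f(1) no by blast
      qed
      then obtain a d where ad: "0 < d" "a + k * d < N" "\<forall>i\<le>k. c (a + i * d) = c a"
        unfolding has_ap_def by blast
      \<comment> \<open>Passing from \<open>N\<close> to \<open>2 * N\<close> leaves room for the
        term after the longer progression, since its difference is below \<open>N\<close>.\<close>
      have "d \<le> k * d" using False by simp
      then have "a + Suc k * d < 2 * N" using ad(2) unfolding mult_Suc by linarith
      then show ?thesis using ad less_Suc_eq_le by blast
    qed
    then show ?thesis unfolding vdw_bound_def by blast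
  qed
qed

section \<open>Brauer's theorem: a monochromatic progression together with its difference\<close>

text \<open>Induction on the number of colours. Take a long monochromatic progression with
  difference \<open>d\<close>. If some \<open>j * d\<close> with \<open>1 <= j <= M\<close> has its
  colour, every \<open>j\<close>-th term gives the progression with difference \<open>j * d\<close>.
  Otherwise \<open>d, ..., M * d\<close> avoid that colour, and the induction hypothesis applies to
  these multiples.\<close>

theorem brauer:
  "\<exists>M. \<forall>(c :: nat \<Rightarrow> nat) C. finite C \<longrightarrow> card C = r \<longrightarrow> c ` {1..M} \<subseteq> C \<longrightarrow>
     (\<exists>a y. 0 < a \<and> 0 < y \<and> y \<le> M \<and> a + L * y \<le> M \<and> (\<forall>i\<le>L. c (a + i * y) = c y))"
proof (induction r)
  case 0
  show ?case by (rule exI[of _ 1]) auto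
next
  case (Suc r)
  then obtain M where M: "\<And>(c :: nat \<Rightarrow> nat) C. finite C \<Longrightarrow> card C = r \<Longrightarrow> c ` {1..M} \<subseteq> C \<Longrightarrow>
     \<exists>a y. 0 < a \<and> 0 < y \<and> y \<le> M \<and> a + L * y \<le> M \<and> (\<forall>i\<le>L. c (a + i * y) = c y)"
    by blast
  obtain W where W: "vdw_bound (L * M + 1) (Suc r) W" using van_der_waerden by blast
  have "\<exists>a y. 0 < a \<and> 0 < y \<and> y \<le> W * (M + 1) \<and> a + L * y \<le> W * (M + 1) \<and>
      (\<forall>i\<le>L. c (a + i * y) = c y)"
    if C: "finite C" "card C = Suc r" "c ` {1..W * (M + 1)} \<subseteq> C" for c :: "nat \<Rightarrow> nat" and C
  proof -
    have "W \<le> W * (M + 1)" by simp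
    \<comment> \<open>The shift by one keeps the progression within the positive integers.\<close>
    then have "(\<lambda>i. c (Suc i)) ` {..<W} \<subseteq> C"
      using C(3) by (auto simp: image_subset_iff)
    then obtain a d where ad: "0 < d" "a + (L * M + 1) * d < W"
        "\<And>i. i < L * M + 1 \<Longrightarrow> c (Suc (a + i * d)) = c (Suc a)"
      using vdw_boundD[of "L * M + 1" C W "\<lambda>i. c (Suc i)"] W C(1,2) by metis
    have dW: "d \<le> W" using ad(2) by simp
    show ?thesis
    proof (cases "\<exists>j\<in>{1..M}. c (j * d) = c (Suc a)")
      case True
      then obtain j where j: "1 \<le> j" "j \<le> M" "c (j * d) = c (Suc a)" by auto
      have "c (Suc a + i * (j * d)) = c (j * d)" if "i \<le> L" for i
      proof -
        have "i * j \<le> L * M" using that j by (intro mult_le_mono)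
        then show ?thesis using ad(3)[of "i * j"] j(3) by (simp add: mult.assoc)
      qed
      moreover have "j * d \<le> W * (M + 1)"
        using mult_le_mono[OF j(2) dW] by (simp add: algebra_simps)
      moreover have "Suc a + L * (j * d) \<le> W * (M + 1)"
      proof -
        have "L * (j * d) \<le> L * M * d" using j(2) by simp
        then have "Suc a + L * (j * d) \<le> W" using ad(2) unfolding distrib_right by linarith
        then show ?thesis using \<open>W \<le> W * (M + 1)\<close> by linarith
      qed
      moreover have "0 < j * d" using j ad(1) by simp
      ultimately show ?thesis by blast
    next
      case False
      have "c (Suc a) \<in> C" using C(3) ad(2) \<open>W \<le> W * (M + 1)\<close> by (auto simp: image_subset_iff)
      then have "card (C - {c (Suc a)}) = r" using C by simp
      moreover have jd: "j * d \<le> W * (M + 1)" if "j \<le> M" for j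
        using mult_le_mono[OF that dW] by (simp add: algebra_simps)
      moreover have "(\<lambda>j. c (j * d)) ` {1..M} \<subseteq> C - {c (Suc a)}"
        using C(3) False jd ad(1) by (auto simp: image_subset_iff)
      ultimately obtain b y where by': "0 < b" "0 < y" "y \<le> M" "b + L * y \<le> M"
          "\<forall>i\<le>L. c ((b + i * y) * d) = c (y * d)"
        using M[of "C - {c (Suc a)}" "\<lambda>j. c (j * d)"] C(1) by blast
      have "b * d + L * (y * d) \<le> W * (M + 1)" using jd[OF by'(4)] by (simp add: algebra_simps)
      moreover have "\<forall>i\<le>L. c (b * d + i * (y * d)) = c (y * d)"
        using by'(5) by (simp add: algebra_simps)
      moreover have "0 < b * d" "0 < y * d" using by' ad(1) by simp_all
      ultimately show ?thesis using jd[OF by'(3)] by blast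
    qed
  qed
  then show ?case by blast
qed

section \<open>Sets of upper density zero\<close>

text \<open>The proportion of \<open>U\<close> in \<open>{1..n}\<close> tends to 0, written without
  division. The negation says that \<open>U\<close> has positive upper density.\<close>

definition null_density :: "nat set \<Rightarrow> bool" where
  "null_density U \<longleftrightarrow> (\<forall>m. \<forall>\<^sub>F n in sequentially. m * card (U \<inter> {1..n}) \<le> n)"

lemma null_density_empty: "null_density {}"
  by (simp add: null_density_def)

lemma null_density_Un:
  assumes "null_density U" "null_density V"
  shows "null_density (U \<union> V)"
  unfolding null_density_def
proof
  fix m
  have "\<forall>\<^sub>F n in sequentially. (2 * m) * card (U \<inter> {1..n}) \<le> n"
    "\<forall>\<^sub>F n in sequentially. (2 * m) * card (V \<inter> {1..n}) \<le> n"
    using assms unfolding null_density_def by blast+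
  then show "\<forall>\<^sub>F n in sequentially. m * card ((U \<union> V) \<inter> {1..n}) \<le> n"
  proof eventually_elim
    case (elim n)
    have "card ((U \<union> V) \<inter> {1..n}) \<le> card (U \<inter> {1..n}) + card (V \<inter> {1..n})"
      by (metis Int_Un_distrib2 card_Un_le)
    then have "m * card ((U \<union> V) \<inter> {1..n}) \<le> m * (card (U \<inter> {1..n}) + card (V \<inter> {1..n}))"
      by (rule mult_le_mono2)
    then show ?case using elim by (simp add: algebra_simps)
  qed
qed

lemma null_density_UN:
  assumes "finite I" "\<And>i. i \<in> I \<Longrightarrow> null_density (U i)"
  shows "null_density (\<Union>i\<in>I. U i)"
  using assms by (induction I) (auto intro: null_density_empty null_density_Un)

text \<open>Multiplication by \<open>j\<close> maps the part in \<open>{1..n}\<close> injectively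
  into \<open>U \<inter> {1..j * n}\<close>. Applying the hypothesis with \<open>m * j\<close> in
  place of \<open>m\<close> absorbs the longer interval.\<close>

lemma null_density_dilation:
  assumes "null_density U" "0 < j"
  shows "null_density {d. j * d \<in> U}"
  unfolding null_density_def
proof
  fix m
  obtain n0 where n0: "\<And>n. n0 \<le> n \<Longrightarrow> (m * j) * card (U \<inter> {1..n}) \<le> n"
    using assms(1) unfolding null_density_def eventually_sequentially by blast
  have "m * card ({d. j * d \<in> U} \<inter> {1..n}) \<le> n" if "n0 \<le> n" for n
  proof -
    have "(*) j ` ({d. j * d \<in> U} \<inter> {1..n}) \<subseteq> U \<inter> {1..j * n}" using assms(2) by auto
    moreover have "inj_on ((*) j) ({d. j * d \<in> U} \<inter> {1..n})" using assms(2) by (auto intro: inj_onI)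
    ultimately have "card ({d. j * d \<in> U} \<inter> {1..n}) \<le> card (U \<inter> {1..j * n})"
      by (meson card_inj_on_le finite_Int finite_atLeastAtMost)
    then have "(m * j) * card ({d. j * d \<in> U} \<inter> {1..n}) \<le> (m * j) * card (U \<inter> {1..j * n})"
      by (rule mult_le_mono2)
    also have "\<dots> \<le> j * n" using assms(2) that by (intro n0) (simp add: le_trans)
    finally show ?thesis using assms(2) by (simp add: mult.assoc mult.left_commute[of _ j])
  qed
  then show "\<forall>\<^sub>F n in sequentially. m * card ({d. j * d \<in> U} \<inter> {1..n}) \<le> n"
    unfolding eventually_sequentially by blast
qed

text \<open>The bad \<open>d\<close> form a finite union of null sets, which cannot contain all
  positive integers.\<close>

lemma null_density_avoid_dilate:
  assumes "null_density U"
  obtains d where "0 < d" "\<And>j. j \<in> {1..M} \<Longrightarrow> j * d \<notin> U"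
proof -
  have null: "null_density (\<Union>j\<in>{1..M}. {d. j * d \<in> U})"
    by (intro null_density_UN null_density_dilation assms) auto
  have "\<exists>d>0. d \<notin> (\<Union>j\<in>{1..M}. {d. j * d \<in> U})"
  proof (rule ccontr)
    assume "\<not> ?thesis"
    then have full: "(\<Union>j\<in>{1..M}. {d. j * d \<in> U}) \<inter> {1..n} = {1..n}" for n
      by (intro Int_absorb1 subsetI) (metis atLeastAtMost_iff less_eq_Suc_le One_nat_def)
    have "\<forall>\<^sub>F n in sequentially. 2 * n \<le> n"
      using spec[OF null[unfolded null_density_def], of 2] unfolding full by simp
    then obtain n0 :: nat where "\<forall>n\<ge>n0. 2 * n \<le> n" unfolding eventually_sequentially by blast
    then show False by (auto dest: spec[of _ "Suc n0"])
  qed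
  then show ?thesis using that by blast
qed

lemma finite_null_density:
  assumes "finite U"
  shows "null_density U"
  unfolding null_density_def eventually_sequentially
proof (intro allI exI impI)
  fix m n assume "m * card U \<le> n"
  moreover have "m * card (U \<inter> {1..n}) \<le> m * card U"
    using assms by (intro mult_le_mono2 card_mono) auto
  ultimately show "m * card (U \<inter> {1..n}) \<le> n" by linarith
qed

section \<open>Differences of sets of positive upper density\<close>

text \<open>The condition makes the translates of \<open>A\<close> by elements of \<open>S\<close>
  pairwise disjoint. For arbitrarily large \<open>n\<close>, \<open>A\<close> fills more than
  \<open>1 / m\<close> of \<open>{1..n}\<close>, while all translates of that portion fit into an
  interval only slightly longer than \<open>n\<close>.\<close>

lemma separated_card_bound:
  assumes "\<not> null_density A"
  obtains m where "\<And>S :: int set. finite S \<Longrightarrow>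
    (\<And>s t a b. s \<in> S \<Longrightarrow> t \<in> S \<Longrightarrow> a \<in> A \<Longrightarrow> b \<in> A \<Longrightarrow> s + int a = t + int b \<Longrightarrow> s = t) \<Longrightarrow> card S \<le> m"
proof -
  obtain m where m: "\<And>n0. \<exists>n\<ge>n0. n < m * card (A \<inter> {1..n})"
    using assms unfolding null_density_def eventually_sequentially by (meson not_le)
  have "card S \<le> m" if S: "finite S"
    "\<And>s t a b. s \<in> S \<Longrightarrow> t \<in> S \<Longrightarrow> a \<in> A \<Longrightarrow> b \<in> A \<Longrightarrow> s + int a = t + int b \<Longrightarrow> s = t"
    for S :: "int set"
  proof (rule ccontr)
    assume big: "\<not> card S \<le> m"
    obtain w where w: "\<And>s. s \<in> S \<Longrightarrow> \<bar>s\<bar> \<le> int w"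
    proof
      fix s assume "s \<in> S"
      then have "nat \<bar>s\<bar> \<le> Max ((\<lambda>s. nat \<bar>s\<bar>) ` S)" using S(1) by (intro Max_ge) auto
      then show "\<bar>s\<bar> \<le> int (Max ((\<lambda>s. nat \<bar>s\<bar>) ` S))" by linarith
    qed
    \<comment> \<open>Such a large \<open>n\<close> makes the overhang \<open>2 * w + 1\<close>
      caused by the shifts cost at most \<open>n\<close> after multiplication by
      \<open>m\<close>.\<close>
    obtain n where n: "m * (2 * w + 1) \<le> n" "n < m * card (A \<inter> {1..n})" using m by blast
    have "inj_on (\<lambda>(s, a). s + int a) (S \<times> (A \<inter> {1..n}))"
    proof (rule inj_onI, clarify)
      fix s a t b
      assume "s \<in> S" "t \<in> S" "a \<in> A" "b \<in> A" "s + int a = t + int b"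
      then show "s = t \<and> a = b" using S(2)[of s t a b] by simp
    qed
    moreover have "(\<lambda>(s, a). s + int a) ` (S \<times> (A \<inter> {1..n})) \<subseteq> {- int w..int n + int w}"
      using w by (force simp: abs_le_iff)
    ultimately have "card (S \<times> (A \<inter> {1..n})) \<le> card {- int w..int n + int w}"
      by (meson card_inj_on_le finite_atLeastAtMost_int)
    also have "\<dots> = n + 2 * w + 1" by simp
    finally have "card S * card (A \<inter> {1..n}) \<le> n + 2 * w + 1" by (simp add: card_cartesian_product)
    then have "m * (card S * card (A \<inter> {1..n})) \<le> m * (n + 2 * w + 1)" by (rule mult_le_mono2)
    also have "\<dots> \<le> m * n + n" using n(1) by (simp add: algebra_simps)
    finally have "card S * (m * card (A \<inter> {1..n})) \<le> Suc m * n" by (simp add: algebra_simps)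
    also have "\<dots> \<le> card S * n" using big by (intro mult_le_mono1) simp
    finally show False using n(2) big by (auto simp: mult_le_cancel1)
  qed
  then show ?thesis using that by blast
qed

text \<open>Choose \<open>S\<close> in \<open>H\<close> of largest size with disjoint translates of
  \<open>A\<close>. For any other \<open>v\<close> in \<open>H\<close>, the translate by
  \<open>v\<close> meets the one by some \<open>s\<close> in \<open>S\<close>, so
  \<open>v - s\<close> is a difference of elements of \<open>A\<close>.\<close>

lemma difference_set_syndetic:
  assumes "\<not> null_density A"
  obtains S where "finite S" "S \<subseteq> H"
    "\<And>v. v \<in> H \<Longrightarrow> \<exists>s\<in>S. \<exists>a\<in>A. \<exists>b\<in>A. v = s + (int a - int b)"
proof -
  define sep where "sep S \<longleftrightarrow> finite S \<and> S \<subseteq> H \<and>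
    (\<forall>s\<in>S. \<forall>t\<in>S. \<forall>a\<in>A. \<forall>b\<in>A. s + int a = t + int b \<longrightarrow> s = t)" for S
  obtain m where m: "\<And>S. sep S \<Longrightarrow> card S \<le> m"
    using separated_card_bound[OF assms] unfolding sep_def by metis
  have "sep {}" by (simp add: sep_def)
  then obtain S where S: "sep S" "\<And>T. sep T \<Longrightarrow> card T \<le> card S"
    using ex_has_greatest_nat[of sep "{}" card "Suc m"] m by (meson le_imp_less_Suc)
  obtain a0 where a0: "a0 \<in> A" using assms null_density_empty by fastforce
  have "\<exists>s\<in>S. \<exists>a\<in>A. \<exists>b\<in>A. v = s + (int a - int b)" if v: "v \<in> H" for v
  proof (cases "v \<in> S")
    case True
    then show ?thesis using a0 by force
  next
    case False
    then have "\<not> sep (insert v S)" using S unfolding sep_def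
      by (metis S(2) card_insert_disjoint not_less_eq_eq order_refl)
    then obtain s t a b where st: "s \<in> insert v S" "t \<in> insert v S" "a \<in> A" "b \<in> A"
        "s + int a = t + int b" "s \<noteq> t"
      using S(1) v unfolding sep_def by blast
    then consider "s = v" "t \<in> S" | "t = v" "s \<in> S" using S(1) unfolding sep_def by blast
    then show ?thesis
    proof cases
      case 1
      then have "v = t + (int b - int a)" using st(5) by simp
      then show ?thesis using 1 st by blast
    next
      case 2
      then have "v = s + (int a - int b)" using st(5) by simp
      then show ?thesis using 2 st by blast
    qed
  qed
  then show ?thesis using that S(1) unfolding sep_def by blast
qed

section \<open>The expressions with many variables\<close>

text \<open>A negative multiple of \<open>x\<close> is obtained by adding a multiple of an element
  of the opposite sign: \<open>x * q + (- q - 1) * x = - x\<close>, where both coefficients are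
  nonnegative if \<open>0 <= x\<close>, and similarly with \<open>p\<close>.\<close>

lemma additive_int_set_uminus:
  fixes H :: "int set"
  assumes zero: "0 \<in> H" and add: "\<And>x y. x \<in> H \<Longrightarrow> y \<in> H \<Longrightarrow> x + y \<in> H"
    and p: "p \<in> H" "0 < p" and q: "q \<in> H" "q < 0" and x: "x \<in> H"
  shows "- x \<in> H"
proof -
  have mult: "k * h \<in> H" if "h \<in> H" "0 \<le> k" for h k
    using that(2)
  proof (induction k rule: int_ge_induct)
    case base
    show ?case using zero by simp
  next
    case (step i)
    then have "h + i * h \<in> H" by (intro add that(1))
    then show ?case by (simp add: algebra_simps)
  qed
  show ?thesis
  proof (cases "0 \<le> x")
    case True
    have "x * q + (- q - 1) * x \<in> H" using True q x by (intro add mult) auto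
    then show ?thesis by (simp add: algebra_simps)
  next
    case False
    have "(- x) * p + (p - 1) * x \<in> H" using False p x by (intro add mult) auto
    then show ?thesis by (simp add: algebra_simps)
  qed
qed

text \<open>
  Fix \<open>u \<in> A\<close> that is not the minimum. The sums of elements of \<open>A - u\<close> then form a group \<open>H\<close>
  containing \<open>A - A\<close>, and \<open>H\<close> is covered by finitely many translates of \<open>A - A\<close> by elements of \<open>H\<close>,
  each a sum of boundedly many elements of \<open>A - u\<close>. This bound depends on \<open>A\<close> alone.
\<close>

lemma long_sums:
  assumes "\<not> null_density A"
  obtains K where "\<And>n a y t. K < n \<Longrightarrow> a \<in> A \<Longrightarrow> y \<in> A \<Longrightarrow> a + y \<in> A \<Longrightarrow>
    \<exists>xs. length xs = n \<and> set xs \<subseteq> A \<and> sum_list xs + t * y \<in> A"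
proof -
  have "infinite A" using assms finite_null_density by blast
  then have unbounded: "\<exists>u\<in>A. n < u" for n
    unfolding finite_nat_set_iff_bounded_le by (meson not_le)
  \<comment> \<open>Elements of \<open>A\<close> on both sides of \<open>u\<close> provide a
    positive and a negative element of \<open>H\<close>, so that \<open>H\<close> is closed under
    negation.\<close>
  obtain u where u: "u \<in> A" "Inf A < u" using unbounded by blast
  obtain u' where u': "u' \<in> A" "u < u'" using unbounded by blast
  have l: "Inf A \<in> A" using u(1) by (intro Inf_nat_def1) auto
  define w where "w xs = int (sum_list xs) - int (length xs) * int u" for xs
  define H where "H = w ` {xs. set xs \<subseteq> A}"
  have w_append: "w (xs @ ys) = w xs + w ys" for xs ys
    by (simp add: w_def algebra_simps)
  have H_add: "x + y \<in> H" if "x \<in> H" "y \<in> H" for x y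
    using that unfolding H_def by (auto simp: w_append[symmetric] intro!: imageI)
  have H_elem: "int a - int u \<in> H" if "a \<in> A" for a
    unfolding H_def using that by (intro image_eqI[of _ _ "[a]"]) (auto simp: w_def)
  have H_uminus: "- x \<in> H" if "x \<in> H" for x
  proof (rule additive_int_set_uminus[OF _ H_add H_elem[OF u'(1)] _ H_elem[OF l] _ that])
    show "0 \<in> H" using H_elem[OF u(1)] by simp
  qed (use u u' in auto)
  have H_diff: "x - y \<in> H" if "x \<in> H" "y \<in> H" for x y
    using H_add[OF that(1) H_uminus[OF that(2)]] by simp
  obtain S where S: "finite S" "S \<subseteq> H"
    "\<And>v. v \<in> H \<Longrightarrow> \<exists>s\<in>S. \<exists>a\<in>A. \<exists>b\<in>A. v = s + (int a - int b)"
    using difference_set_syndetic[OF assms] by metis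
  have "\<forall>s\<in>S. \<exists>xs. set xs \<subseteq> A \<and> - s = w xs" using S(2) H_uminus unfolding H_def by blast
  then obtain X where X: "\<And>s. s \<in> S \<Longrightarrow> set (X s) \<subseteq> A \<and> - s = w (X s)" by metis
  define K where "K = Max (insert 0 ((\<lambda>s. length (X s)) ` S))"
  have K: "length (X s) \<le> K" if "s \<in> S" for s
    unfolding K_def using that S(1) by (intro Max_ge) auto
  have "\<exists>xs. length xs = n \<and> set xs \<subseteq> A \<and> sum_list xs + t * y \<in> A"
    if n: "K < n" and a: "a \<in> A" and y: "y \<in> A" and ay: "a + y \<in> A" for n a y t
  proof -
    \<comment> \<open>\<open>H\<close> contains all differences of elements of \<open>A\<close>,
      hence \<open>y = (a + y) - a\<close>, and then \<open>u = y - (y - u)\<close>.\<close>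
    have yH: "int y \<in> H" using H_diff[OF H_elem[OF ay] H_elem[OF a]] by simp
    have uH: "int u \<in> H" using H_diff[OF yH H_elem[OF y]] by simp
    have mult: "int k * h \<in> H" if "h \<in> H" for k h
      by (induction k) (use that H_diff[OF that that] H_add in \<open>auto simp: algebra_simps\<close>)
    have "int t * int y + int (n - 1) * int u \<in> H" using yH uH by (intro H_add mult)
    then obtain s b z where s: "s \<in> S" and bz: "z \<in> A" "b \<in> A"
        "int t * int y + int (n - 1) * int u = s + (int z - int b)"
      using S(3) by blast
    \<comment> \<open>Padding by \<open>u\<close> leaves \<open>w\<close> unchanged and brings the
      length to \<open>n - 1\<close>, possible as \<open>length (X s) <= K < n\<close>. The last
      summand is \<open>b\<close>, and the total becomes \<open>z\<close>.\<close>
    define ys where "ys = X s @ replicate (n - 1 - length (X s)) u"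
    have len: "length ys = n - 1" unfolding ys_def using K[OF s] n by simp
    have "w ys = - s" unfolding ys_def w_append using X[OF s] by (simp add: w_def sum_list_replicate)
    then have "int (sum_list ys) = int (n - 1) * int u - s" using len by (simp add: w_def)
    then have "int (sum_list (b # ys) + t * y) = int z" using bz(3) by simp
    then have "sum_list (b # ys) + t * y = z" by (simp only: of_nat_eq_iff)
    moreover have "set (b # ys) \<subseteq> A" using X[OF s] u(1) bz(2) unfolding ys_def by auto
    moreover have "length (b # ys) = n" using len n by simp
    ultimately show ?thesis using bz(1) by blast
  qed
  then show ?thesis using that by blast
qed

section \<open>One colour class for small and large \<open>n\<close>\<close>

lemma monochromatic_sums:
  fixes c :: "nat \<Rightarrow> nat"
  assumes fin: "finite (c ` {1..})"
  obtains y where "0 < y"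
    "\<And>n. 1 \<le> n \<Longrightarrow> \<exists>xs. length xs = n \<and> set xs \<subseteq> {k. 0 < k \<and> c k = c y} \<and>
       sum_list xs + 2 ^ n * y \<in> {k. 0 < k \<and> c k = c y}"
proof -
  define A where "A q = {k. 0 < k \<and> c k = q}" for q
  define Q where "Q = c ` {1..}"
  define U where "U = (\<Union>q\<in>{q \<in> Q. null_density (A q)}. A q)"
  have nullU: "null_density U"
    unfolding U_def using fin by (intro null_density_UN) (auto simp: Q_def)
  have "\<exists>K. \<forall>n a y t. K < n \<longrightarrow> a \<in> A q \<longrightarrow> y \<in> A q \<longrightarrow> a + y \<in> A q \<longrightarrow>
    (\<exists>xs. length xs = n \<and> set xs \<subseteq> A q \<and> sum_list xs + t * y \<in> A q)"
    if "\<not> null_density (A q)" for q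
    using long_sums[OF that] by metis
  then obtain K where K: "\<And>q n a y t. \<not> null_density (A q) \<Longrightarrow> K q < n \<Longrightarrow>
      a \<in> A q \<Longrightarrow> y \<in> A q \<Longrightarrow> a + y \<in> A q \<Longrightarrow>
      \<exists>xs. length xs = n \<and> set xs \<subseteq> A q \<and> sum_list xs + t * y \<in> A q"
    by metis
  define N where "N = Max (insert 0 (K ` Q))"
  have N: "K q \<le> N" if "q \<in> Q" for q
    unfolding N_def using that fin by (intro Max_ge) (auto simp: Q_def)
  \<comment> \<open>For \<open>n <= N\<close> the multiplier \<open>n - 1 + 2 ^ n\<close> is at most
    \<open>L\<close>. Since \<open>N\<close> depends on the colouring alone, \<open>L\<close> and
    \<open>M\<close> are fixed before \<open>d\<close> is chosen.\<close>
  define L where "L = N + 2 ^ N"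
  have "finite Q" using fin by (simp add: Q_def)
  obtain M where M: "\<forall>(c :: nat \<Rightarrow> nat) C. finite C \<longrightarrow> card C = card Q \<longrightarrow> c ` {1..M} \<subseteq> C \<longrightarrow>
      (\<exists>a y. 0 < a \<and> 0 < y \<and> y \<le> M \<and> a + L * y \<le> M \<and> (\<forall>i\<le>L. c (a + i * y) = c y))"
    using brauer[of "card Q" L] by (rule exE)
  obtain d where d: "0 < d" "\<And>j. j \<in> {1..M} \<Longrightarrow> j * d \<notin> U"
    using null_density_avoid_dilate[OF nullU, of M] by metis
  have "(\<lambda>j. c (j * d)) ` {1..M} \<subseteq> Q" using d(1) by (auto simp: Q_def)
  from M[rule_format, OF \<open>finite Q\<close> refl this] obtain a' y' where ay': "0 < a'" "0 < y'" "y' \<le> M"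
      "\<forall>i\<le>L. c ((a' + i * y') * d) = c (y' * d)" by blast
  define a y where "a = a' * d" and "y = y' * d"
  have pos: "0 < a" "0 < y" using ay' d(1) by (simp_all add: a_def y_def)
  have ap: "a + i * y \<in> A (c y)" if "i \<le> L" for i
  proof -
    have "a + i * y = (a' + i * y') * d" by (simp add: a_def y_def algebra_simps)
    then show ?thesis using ay' d(1) that by (simp add: A_def y_def)
  qed
  have yA: "y \<in> A (c y)" using pos by (simp add: A_def)
  have yQ: "c y \<in> Q" using pos by (auto simp: Q_def)
  \<comment> \<open>As \<open>y\<close> is one of the first \<open>M\<close> multiples of
    \<open>d\<close>, it avoids \<open>U\<close>, so its class is not a null set.\<close>
  have dense: "\<not> null_density (A (c y))"
    using d(2)[of y'] ay' yA yQ unfolding U_def y_def by auto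
  have "\<exists>xs. length xs = n \<and> set xs \<subseteq> A (c y) \<and> sum_list xs + 2 ^ n * y \<in> A (c y)"
    if n: "1 \<le> n" for n
  proof (cases "n \<le> N")
    case True
    have "(2::nat) ^ n \<le> 2 ^ N" using True by simp
    then have "n - 1 + 2 ^ n \<le> L" unfolding L_def using True by linarith
    from ap[OF this] have "sum_list (a # replicate (n - 1) y) + 2 ^ n * y \<in> A (c y)"
      by (simp add: sum_list_replicate algebra_simps)
    moreover have "set (a # replicate (n - 1) y) \<subseteq> A (c y)"
      using ap[of 0] yA by (simp add: set_replicate_conv_if)
    moreover have "length (a # replicate (n - 1) y) = n" using n by simp
    ultimately show ?thesis by blast
  next
    case False
    then have "K (c y) < n" using N[OF yQ] by simp
    moreover have "1 \<le> L" by (simp add: L_def trans_le_add2)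
    \<comment> \<open>The terms \<open>a\<close> and \<open>a + y\<close> of the progression supply
      the hypotheses for long sums, used with \<open>t = 2 ^ n\<close>.\<close>
    ultimately show ?thesis using K[OF dense _ _ yA] ap[of 0] ap[of 1] by simp
  qed
  then show ?thesis using that pos(2) unfolding A_def by blast
qed

section \<open>The system\<close>

lemma sys_exprs_cases:
  assumes "i \<in> sys_exprs"
  obtains n where "i = SumExpr n" "1 \<le> n" | "i = VarExpr Y"
    | n j where "i = VarExpr (X n j)" "1 \<le> n" "1 \<le> j" "j \<le> n"
  using assms unfolding sys_exprs_def sys_vars_def by blast

lemma sys_regular_nat: "image_partition_regular_nat sys_exprs sys_vars sys_matrix"
  unfolding image_partition_regular_nat_def image_partition_regular_on_def
proof (intro allI impI)
  fix c :: "real \<Rightarrow> nat"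
  assume "finite (c ` (\<nat> - {0}))"
  moreover have "(\<lambda>n. c (real n)) ` {1..} \<subseteq> c ` (\<nat> - {0})" by auto
  ultimately have "finite ((\<lambda>n. c (real n)) ` {1..})" by (rule finite_subset[rotated])
  then obtain y where y: "0 < y" and ex: "\<And>n. 1 \<le> n \<Longrightarrow> \<exists>xs. length xs = n \<and>
      set xs \<subseteq> {k. 0 < k \<and> c (real k) = c (real y)} \<and>
      sum_list xs + 2 ^ n * y \<in> {k. 0 < k \<and> c (real k) = c (real y)}"
    using monochromatic_sums[of "\<lambda>n. c (real n)"] by blast
  \<comment> \<open>Only \<open>y\<close> and the colour are shared between different
    \<open>n\<close>, so the lists can be chosen independently.\<close>
  define xs where "xs n = (SOME xs. length xs = n \<and>
      set xs \<subseteq> {k. 0 < k \<and> c (real k) = c (real y)} \<and>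
      sum_list xs + 2 ^ n * y \<in> {k. 0 < k \<and> c (real k) = c (real y)})" for n
  have xs: "length (xs n) = n \<and> set (xs n) \<subseteq> {k. 0 < k \<and> c (real k) = c (real y)} \<and>
      sum_list (xs n) + 2 ^ n * y \<in> {k. 0 < k \<and> c (real k) = c (real y)}" if "1 \<le> n" for n
    unfolding xs_def using ex[OF that] by (rule someI_ex)
  define x where "x v = (case v of Y \<Rightarrow> real y | X n j \<Rightarrow> real (xs n ! (j - 1)))" for v
  have "mat_vec sys_vars sys_matrix x i \<in> \<nat> - {0} \<and>
      c (mat_vec sys_vars sys_matrix x i) = c (real y)" if "i \<in> sys_exprs" for i
    using that
  proof (cases rule: sys_exprs_cases)
    case (1 n)
    have "(\<Sum>j=1..n. xs n ! (j - 1)) = (\<Sum>j<n. xs n ! j)"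
      by (rule sum.reindex_bij_witness[of _ Suc "\<lambda>j. j - 1"]) auto
    also have "\<dots> = sum_list (xs n)" using xs[OF 1(2)] by (simp add: sum_list_sum_nth atLeast0LessThan)
    finally have "mat_vec sys_vars sys_matrix x i = real (sum_list (xs n) + 2 ^ n * y)"
      unfolding 1(1) mat_vec_SumExpr[OF 1(2)] x_def by (simp flip: of_nat_sum)
    then show ?thesis using xs[OF 1(2)] y by (simp del: of_nat_add of_nat_mult)
  next
    case 2
    moreover have "Y \<in> sys_vars" by (simp add: sys_vars_def)
    ultimately show ?thesis using y by (simp add: mat_vec_VarExpr x_def)
  next
    case (3 n j)
    then have "xs n ! (j - 1) \<in> set (xs n)" using xs[OF 3(2)] by simp
    then have "xs n ! (j - 1) \<in> {k. 0 < k \<and> c (real k) = c (real y)}" using xs[OF 3(2)] by blast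
    moreover have "X n j \<in> sys_vars" using 3 by (auto simp: sys_vars_def)
    ultimately show ?thesis using 3 by (simp add: mat_vec_VarExpr x_def)
  qed
  then show "\<exists>x k. \<forall>i\<in>sys_exprs. mat_vec sys_vars sys_matrix x i \<in> \<nat> - {0} \<and>
      c (mat_vec sys_vars sys_matrix x i) = k" by blast
qed

text \<open>With a constant colouring, all variables and expressions are still bounded by
  \<open>\<delta>\<close>. Hence \<open>2 ^ n * \<bar>x Y\<bar> \<le> (n + 1) * \<delta>\<close> for
  every \<open>n >= 1\<close>, so \<open>x Y = 0\<close>, a value that is excluded.\<close>

lemma sys_not_regular_bounded:
  "\<not> image_partition_regular_on ({-\<delta><..<\<delta>} - {0}) sys_exprs sys_vars sys_matrix"
proof
  assume "image_partition_regular_on ({-\<delta><..<\<delta>} - {0}) sys_exprs sys_vars sys_matrix"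
  moreover have "finite ((\<lambda>_. 0 :: nat) ` ({-\<delta><..<\<delta>} - {0}))" by (rule finite_subset[of _ "{0}"]) auto
  ultimately obtain x where x: "\<And>i. i \<in> sys_exprs \<Longrightarrow>
      mat_vec sys_vars sys_matrix x i \<in> {-\<delta><..<\<delta>} - {0}"
    unfolding image_partition_regular_on_def by meson
  have var: "x v \<in> {-\<delta><..<\<delta>} - {0}" if "v \<in> sys_vars" for v
    using x[of "VarExpr v"] that by (simp add: mat_vec_VarExpr sys_exprs_def)
  have "Y \<in> sys_vars" by (simp add: sys_vars_def)
  note Y = var[OF this]
  have "2 ^ n * \<bar>x Y\<bar> \<le> (real n + 1) * \<delta>" if n: "1 \<le> n" for n
  proof -
    have "\<bar>\<Sum>j=1..n. x (X n j)\<bar> \<le> (\<Sum>j=1..n. \<bar>x (X n j)\<bar>)" by (rule sum_abs)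
    also have "\<dots> \<le> (\<Sum>j=1..n. \<delta>)"
    proof (rule sum_mono)
      fix j assume "j \<in> {1..n}"
      then have "X n j \<in> sys_vars" using n by (auto simp: sys_vars_def)
      from var[OF this] show "\<bar>x (X n j)\<bar> \<le> \<delta>" by auto
    qed
    finally have "\<bar>\<Sum>j=1..n. x (X n j)\<bar> \<le> real n * \<delta>" by simp
    moreover have "\<bar>(\<Sum>j=1..n. x (X n j)) + 2 ^ n * x Y\<bar> \<le> \<delta>"
      using x[of "SumExpr n"] n by (auto simp: mat_vec_SumExpr sys_exprs_def)
    moreover have "\<bar>2 ^ n * x Y\<bar> = 2 ^ n * \<bar>x Y\<bar>" by (simp add: abs_mult)
    ultimately show ?thesis by (simp add: algebra_simps)
  qed
  then have "\<forall>\<^sub>F n in sequentially. \<bar>x Y\<bar> \<le> (real n + 1) * \<delta> / 2 ^ n"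
    unfolding eventually_sequentially by (intro exI[of _ 1]) (auto simp: field_simps)
  moreover have "(\<lambda>n. (real n + 1) * \<delta> / 2 ^ n) \<longlonglongrightarrow> 0" by real_asymp
  ultimately have "\<bar>x Y\<bar> \<le> 0" using tendsto_lowerbound[of _ 0 sequentially "\<bar>x Y\<bar>"] by simp
  then show False using Y by simp
qed

theorem theorem4p4:
  "image_partition_regular_nat sys_exprs sys_vars sys_matrix \<and>
   \<not> image_partition_regular_real_near_zero sys_exprs sys_vars sys_matrix"
  using sys_regular_nat sys_not_regular_bounded zero_less_one
  unfolding image_partition_regular_real_near_zero_def by blast

end
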